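(* Let $t\ge 2$ and $k\ge 2$ be integers satisfying $k(t-1)\ge t+1$. For every integer $m\ge k$, let $n=t+2m+1$ and $q=(n+t-1)/2$. Then, for every fixed $t$-element set $T\subseteq[n]$, there exists a $t$-intersecting $k$-Sperner family $\mathcal{F}\subseteq 2^{[n]}$ such that $|\mathcal{F}|>|\mathcal{B}_T(t,k)|$, where $$\mathcal{B}_T(t,k)=\mathcal{S}_T\cup\bigcup_{i=1}^{k-1}\binom{[n]}{q+i}\cup\left(\binom{[n]}{q+k}\setminus\nabla_{q+k}(\mathcal{S}_T)\right),\qquad \mathcal{S}_T=\left\{S\in\binom{[n]}{q}:T\subseteq S\right\}.$$
   Context: For a positive integer $n$, $[n]=\{1,2,\dots,n\}$ and $2^{[n]}$ is the power set of $[n]$. For a set $V$ and an integer $r$, $\binom{V}{r}$ denotes the family of all $r$-element subsets of $V$. A family $\mathcal{F}\subseteq 2^{[n]}$ is $t$-intersecting if $|A\cap B|\ge t$ for all $A,B\in\mathcal{F}$. A family $\mathcal{F}$ is $k$-Sperner if it contains no chain of length $k+1$, i.e., there do not exist sets $A_0\subset A_1\subset\cdots\subset A_k$ (strict inclusions) with all $A_i\in\mathcal{F}$. For a family $\mathcal{H}\subseteq\binom{[n]}{r}$ and an integer $s\ge r$, the $s$-th upper shadow of $\mathcal{H}$ is $$\nabla_s(\mathcal{H})=\left\{A\in\binom{[n]}{s}:\text{ there exists }F\in\mathcal{H}\text{ with }F\subseteq A\right\}.$$ *)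

theory Defs
  imports Main
begin

definition layer :: "nat \<Rightarrow> nat \<Rightarrow> nat set set" where
  "layer n r = {A. A \<subseteq> {1..n} \<and> card A = r}"

definition t_intersecting :: "nat \<Rightarrow> nat set set \<Rightarrow> bool" where
  "t_intersecting t F \<longleftrightarrow> (\<forall>A\<in>F. \<forall>B\<in>F. t \<le> card (A \<inter> B))"

definition k_Sperner :: "nat \<Rightarrow> nat set set \<Rightarrow> bool" where
  "k_Sperner k F \<longleftrightarrow>
     \<not> (\<exists>A :: nat \<Rightarrow> nat set. (\<forall>i\<le>k. A i \<in> F) \<and> (\<forall>i<k. A i \<subset> A (Suc i)))"

definition upper_shadow :: "nat \<Rightarrow> nat \<Rightarrow> nat set set \<Rightarrow> nat set set" where
  "upper_shadow n s H = {A \<in> layer n s. \<exists>F\<in>H. F \<subseteq> A}"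

definition star_family :: "nat \<Rightarrow> nat \<Rightarrow> nat set \<Rightarrow> nat set set" where
  "star_family n q T = {S \<in> layer n q. T \<subseteq> S}"

definition B_family :: "nat \<Rightarrow> nat \<Rightarrow> nat \<Rightarrow> nat set \<Rightarrow> nat set set" where
  "B_family n q k T =
     star_family n q T
     \<union> (\<Union>i\<in>{1..k - 1}. layer n (q + i))
     \<union> (layer n (q + k) - upper_shadow n (q + k) (star_family n q T))"

end

theory Submission
  imports Defs "HOL.Binomial_Plus"
begin

text \<open>
  Replace the star of \<open>T\<close> in layer \<open>q\<close> by the Frankl family of the \<open>q\<close>-sets meeting a fixed
  \<open>(t + 2)\<close>-set \<open>J\<close> in at least \<open>t + 1\<close> points, keeping the rest of the construction.  Only
  \<open>|\<A>| - |\<nabla>\<^bsub>q+k\<^esub> \<A>|\<close> matters for the comparison.  With \<open>c\<^sub>j = (2m-1 choose m+j-1)\<close> the new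
  family wins iff \<open>(t - 1)(c\<^sub>1 - c\<^sub>k) > c\<^sub>k - c\<^bsub>k+1\<^esub>\<close>.  Since \<open>c\<^sub>j - c\<^bsub>j+1\<^esub> = (j/m) (2m choose m+j)\<close>
  and the binomials decrease in \<open>j\<close>, telescoping gives
  \<open>c\<^sub>1 - c\<^sub>k > (k - 1)/2 \<cdot> (c\<^sub>k - c\<^bsub>k+1\<^esub>)\<close>, and \<open>(t - 1)(k - 1) \<ge> 2\<close> is exactly the hypothesis on
  \<open>k\<close> and \<open>t\<close>.
\<close>

section \<open>Families over a prescribed bottom layer\<close>

definition layered_family :: "nat \<Rightarrow> nat \<Rightarrow> nat \<Rightarrow> nat set set \<Rightarrow> nat set set" where
  "layered_family n q k H =
     H \<union> (\<Union>i\<in>{1..k - 1}. layer n (q + i)) \<union> (layer n (q + k) - upper_shadow n (q + k) H)"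

text \<open>The size \<open>r\<close> is a parameter because the same trace condition, read at size
  \<open>q + k\<close>, bounds the upper shadow.\<close>

definition frankl_family :: "nat \<Rightarrow> nat \<Rightarrow> nat \<Rightarrow> nat set \<Rightarrow> nat set set" where
  "frankl_family n r t J = {A \<in> layer n r. t + 1 \<le> card (A \<inter> J)}"

lemma finite_layer [simp]: "finite (layer n r)"
  by (rule finite_subset[of _ "Pow {1..n}"]) (auto simp: layer_def)

lemma upper_shadow_subset_layer: "upper_shadow n s H \<subseteq> layer n s"
  by (auto simp: upper_shadow_def)

text \<open>The right side depends on \<open>H\<close> only through \<open>card H\<close>, so two
  bottom families compare by size minus shadow size. Adding the shadow on the left avoids truncated
  subtraction.\<close>

lemma card_layered_family:
  assumes "H \<subseteq> layer n q" "k \<ge> 1"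
  shows "card (layered_family n q k H) + card (upper_shadow n (q + k) H)
       = card H + card (\<Union>i\<in>{1..k - 1}. layer n (q + i)) + card (layer n (q + k))"
proof -
  let ?M = "\<Union>i\<in>{1..k - 1}. layer n (q + i)"
  let ?D = "layer n (q + k) - upper_shadow n (q + k) H"
  have fin: "finite H" "finite ?M" "finite ?D"
    using assms by (auto intro: finite_subset)
  have "H \<inter> ?M = {}" "(H \<union> ?M) \<inter> ?D = {}"
    using assms by (auto simp: layer_def)
  then have "card (layered_family n q k H) = card H + card ?M + card ?D"
    unfolding layered_family_def using fin by (simp add: card_Un_disjoint)
  moreover have "card ?D + card (upper_shadow n (q + k) H) = card (layer n (q + k))"
    using upper_shadow_subset_layer[of n "q + k" H]
    by (metis card_Diff_subset card_mono finite_layer finite_subset le_add_diff_inverse2)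
  ultimately show ?thesis by simp
qed

lemma layered_family_in_layer:
  assumes "H \<subseteq> layer n q" "A \<in> layered_family n q k H"
  shows "A \<subseteq> {1..n}" "q \<le> card A" "card A \<le> q + k" "card A = q \<Longrightarrow> k \<ge> 1 \<Longrightarrow> A \<in> H"
  using assms by (auto simp: layered_family_def layer_def)

text \<open>Member sizes lie between \<open>q\<close> and \<open>q + k\<close>, so a chain of
  \<open>k + 1\<close> sets uses every size. Its top then contains its bottom, a member of
  \<open>H\<close>, and so lies in the removed shadow.\<close>

lemma k_Sperner_layered_family:
  assumes "H \<subseteq> layer n q" "k \<ge> 1"
  shows "k_Sperner k (layered_family n q k H)"
  unfolding k_Sperner_def
proof
  assume "\<exists>A. (\<forall>i\<le>k. A i \<in> layered_family n q k H) \<and> (\<forall>i<k. A i \<subset> A (Suc i))"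
  then obtain A where A: "\<And>i. i \<le> k \<Longrightarrow> A i \<in> layered_family n q k H"
    and chain: "\<And>i. i < k \<Longrightarrow> A i \<subset> A (Suc i)"
    by auto
  note facts = layered_family_in_layer[OF assms(1) A]
  have fin: "finite (A i)" if "i \<le> k" for i
    using facts(1)[OF that] by (rule finite_subset) simp
  have grow: "A 0 \<subseteq> A i \<and> card (A 0) + i \<le> card (A i)" if "i \<le> k" for i
    using that
  proof (induction i)
    case (Suc i)
    have "card (A i) < card (A (Suc i))"
      using Suc.prems chain fin by (intro psubset_card_mono) auto
    with Suc chain[of i] show ?case by auto
  qed simp
  have sizes: "card (A 0) = q" "card (A k) = q + k"
    using grow[of k] facts(2)[of 0] facts(3)[of k] by auto
  have "A 0 \<in> H"
    using facts(4)[of 0] sizes assms by simp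
  moreover have "A k \<in> layer n (q + k)"
    using facts(1)[of k] sizes by (simp add: layer_def)
  ultimately have "A k \<in> upper_shadow n (q + k) H"
    using grow[of k] by (auto simp: upper_shadow_def)
  moreover have "A k \<notin> H" "A k \<notin> (\<Union>i\<in>{1..k - 1}. layer n (q + i))"
    using sizes assms by (auto simp: layer_def)
  ultimately show False
    using A[of k] by (auto simp: layered_family_def)
qed

lemma card_Int_ge:
  assumes "finite X" "A \<subseteq> X" "B \<subseteq> X"
  shows "card A + card B \<le> card X + card (A \<inter> B)"
proof -
  have "card A + card B = card (A \<union> B) + card (A \<inter> B)"
    using assms by (intro card_Un_Int) (auto intro: finite_subset)
  moreover have "card (A \<union> B) \<le> card X"
    using assms by (intro card_mono) auto
  ultimately show ?thesis by simp
qed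

text \<open>Two members not both of size \<open>q\<close> have sizes summing to at least
  \<open>2 * q + 1\<close>, hence to at least \<open>n + t\<close>, and inclusion-exclusion in
  \<open>{1..n}\<close> suffices.\<close>

lemma t_intersecting_layered_family:
  assumes H: "H \<subseteq> layer n q" "t_intersecting t H" and "k \<ge> 1" "n + t \<le> 2 * q + 1"
  shows "t_intersecting t (layered_family n q k H)"
  unfolding t_intersecting_def
proof (intro ballI)
  fix A B assume A: "A \<in> layered_family n q k H" and B: "B \<in> layered_family n q k H"
  note fA = layered_family_in_layer[OF H(1) A] and fB = layered_family_in_layer[OF H(1) B]
  show "t \<le> card (A \<inter> B)"
  proof (cases "card A = q \<and> card B = q")
    case True
    then show ?thesis
      using fA(4) fB(4) assms by (auto simp: t_intersecting_def)
  next
    case False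
    then show ?thesis
      using card_Int_ge[of "{1..n}" A B] fA fB assms by auto
  qed
qed

text \<open>Two traces of size at least \<open>t + 1\<close> inside the \<open>(t + 2)\<close>-set
  \<open>J\<close> already share \<open>2 * (t + 1) - (t + 2) = t\<close> points.\<close>

lemma t_intersecting_frankl_family:
  assumes "finite J" "card J = t + 2"
  shows "t_intersecting t (frankl_family n r t J)"
  unfolding t_intersecting_def
proof (intro ballI)
  fix A B assume "A \<in> frankl_family n r t J" "B \<in> frankl_family n r t J"
  then have AB: "t + 1 \<le> card (A \<inter> J)" "t + 1 \<le> card (B \<inter> J)" "finite A"
    by (auto simp: frankl_family_def layer_def intro: finite_subset)
  have "t \<le> card ((A \<inter> J) \<inter> (B \<inter> J))"
    using card_Int_ge[of J "A \<inter> J" "B \<inter> J"] AB assms by auto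
  also have "\<dots> \<le> card (A \<inter> B)"
    using AB by (intro card_mono) auto
  finally show "t \<le> card (A \<inter> B)" .
qed

section \<open>Cardinalities by trace on a fixed set\<close>

text \<open>\<open>A\<close> splits uniquely into \<open>A \<inter> J\<close> and
  \<open>A - J\<close>, which are chosen independently.\<close>

lemma card_layer_trace:
  assumes "J \<subseteq> {1..n}" "s \<le> r"
  shows "card {A \<in> layer n r. card (A \<inter> J) = s}
       = (card J choose s) * ((n - card J) choose (r - s))"
proof -
  let ?P = "{B. B \<subseteq> J \<and> card B = s}" and ?Q = "{C. C \<subseteq> {1..n} - J \<and> card C = r - s}"
  have finJ: "finite J" using assms(1) by (rule finite_subset) simp
  have "bij_betw (\<lambda>(B, C). B \<union> C) (?P \<times> ?Q) {A \<in> layer n r. card (A \<inter> J) = s}"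
  proof (rule bij_betw_byWitness[where f' = "\<lambda>A. (A \<inter> J, A - J)"])
    show "\<forall>p\<in>?P \<times> ?Q. ((case p of (B, C) \<Rightarrow> B \<union> C) \<inter> J, (case p of (B, C) \<Rightarrow> B \<union> C) - J) = p"
      by auto
    show "\<forall>A\<in>{A \<in> layer n r. card (A \<inter> J) = s}. (case (A \<inter> J, A - J) of (B, C) \<Rightarrow> B \<union> C) = A"
      by auto
    show "(\<lambda>(B, C). B \<union> C) ` (?P \<times> ?Q) \<subseteq> {A \<in> layer n r. card (A \<inter> J) = s}"
    proof clarify
      fix B C assume *: "B \<subseteq> J" "s = card B" "C \<subseteq> {1..n} - J" "card C = r - card B"
      then have "(B \<union> C) \<inter> J = B" "B \<inter> C = {}" by auto
      moreover have "finite B" "finite C" using * finJ by (auto intro: finite_subset)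
      ultimately show "B \<union> C \<in> layer n r \<and> card ((B \<union> C) \<inter> J) = card B"
        using * assms by (auto simp: layer_def card_Un_disjoint)
    qed
    show "(\<lambda>A. (A \<inter> J, A - J)) ` {A \<in> layer n r. card (A \<inter> J) = s} \<subseteq> ?P \<times> ?Q"
      using finJ by (auto simp: layer_def card_Diff_subset_Int)
  qed
  then have "card {A \<in> layer n r. card (A \<inter> J) = s} = card (?P \<times> ?Q)"
    by (simp add: bij_betw_same_card)
  also have "\<dots> = (card J choose s) * ((n - card J) choose (r - s))"
    using assms finJ by (simp add: card_cartesian_product n_subsets card_Diff_subset)
  finally show ?thesis .
qed

lemma card_star_family:
  assumes "T \<subseteq> {1..n}" "card T \<le> r"
  shows "card (star_family n r T) = (n - card T) choose (r - card T)"
proof -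
  have "finite T" using assms(1) by (rule finite_subset) simp
  then have "star_family n r T = {A \<in> layer n r. card (A \<inter> T) = card T}"
    by (auto simp: star_family_def Int_absorb1 dest: card_subset_eq[of T, OF _ Int_lower2])
  then show ?thesis using card_layer_trace[OF assms] by simp
qed

lemma card_frankl_family:
  assumes J: "J \<subseteq> {1..n}" "card J = t + 2" and "t + 2 \<le> r"
  shows "card (frankl_family n r t J)
       = ((n - (t + 2)) choose (r - (t + 2))) + (t + 2) * ((n - (t + 2)) choose (r - (t + 1)))"
proof -
  let ?L = "\<lambda>s. {A \<in> layer n r. card (A \<inter> J) = s}"
  have "finite J" using J(1) by (rule finite_subset) simp
  then have "card (A \<inter> J) \<le> t + 2" for A
    using card_mono[of J "A \<inter> J"] J by simp
  then have "frankl_family n r t J = ?L (t + 2) \<union> ?L (t + 1)"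
    by (auto simp: frankl_family_def le_antisym not_less_eq_eq)
  moreover have "?L (t + 2) \<inter> ?L (t + 1) = {}" by auto
  ultimately have "card (frankl_family n r t J) = card (?L (t + 2)) + card (?L (t + 1))"
    by (simp add: card_Un_disjoint)
  moreover have "(t + 2) choose (t + 1) = t + 2"
    using binomial_Suc_n[of "t + 1"] by simp
  ultimately show ?thesis
    using card_layer_trace[OF J(1), of "t + 2" r] card_layer_trace[OF J(1), of "t + 1" r] assms
    by simp
qed

section \<open>Bounds on the two upper shadows\<close>

text \<open>A \<open>q\<close>-set fits between \<open>T\<close> and any \<open>s\<close>-set
  containing it. This bounds from below what the star removes from the top layer.\<close>

lemma star_family_subset_upper_shadow:
  assumes "card T \<le> q" "q \<le> s" "finite T"
  shows "star_family n s T \<subseteq> upper_shadow n s (star_family n q T)"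
proof
  fix A assume "A \<in> star_family n s T"
  then have A: "A \<subseteq> {1..n}" "card A = s" "T \<subseteq> A"
    by (auto simp: star_family_def layer_def)
  then have "finite A" by (auto intro: finite_subset)
  then obtain B where "T \<subseteq> B" "B \<subseteq> A" "card B = q"
    using exists_subset_between[of T q A] A assms by auto
  with A have "B \<in> star_family n q T"
    by (auto simp: star_family_def layer_def)
  with A \<open>B \<subseteq> A\<close> show "A \<in> upper_shadow n s (star_family n q T)"
    by (auto simp: upper_shadow_def layer_def)
qed

text \<open>Enlarging a set cannot shrink its trace on \<open>J\<close>. This bounds from above what
  the Frankl family removes.\<close>

lemma upper_shadow_frankl_family_subset:
  assumes "finite J"
  shows "upper_shadow n s (frankl_family n q t J) \<subseteq> frankl_family n s t J"
proof
  fix A assume "A \<in> upper_shadow n s (frankl_family n q t J)"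
  then obtain B where B: "A \<in> layer n s" "B \<subseteq> A" "t + 1 \<le> card (B \<inter> J)"
    by (auto simp: upper_shadow_def frankl_family_def)
  have "card (B \<inter> J) \<le> card (A \<inter> J)"
    using B assms by (intro card_mono) auto
  with B show "A \<in> frankl_family n s t J"
    by (simp add: frankl_family_def)
qed

section \<open>Binomial inequalities\<close>

text \<open>Absorption turns \<open>2 * m\<close> times the first binomial into \<open>m + j\<close>
  times the last one; subtracting \<open>m\<close> times Pascal's rule leaves the claim.\<close>

lemma binomial_odd_difference:
  assumes "m \<ge> 1"
  shows "int m * (int ((2 * m - 1) choose (m + j - 1)) - int ((2 * m - 1) choose (m + j)))
       = int j * int ((2 * m) choose (m + j))"
proof -
  obtain i where i: "m + j = Suc i" using assms by (cases "m + j") auto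
  obtain l where l: "2 * m = Suc l" using assms by (cases "2 * m") auto
  have "Suc i * (Suc l choose Suc i) = Suc l * (l choose i)"
    by (rule Suc_times_binomial)
  then have "int (m + j) * int ((2 * m) choose (m + j))
      = int (2 * m) * int ((2 * m - 1) choose (m + j - 1))"
    unfolding i l by (metis diff_Suc_1 of_nat_mult)
  moreover have "int ((2 * m) choose (m + j))
      = int ((2 * m - 1) choose (m + j - 1)) + int ((2 * m - 1) choose (m + j))"
    unfolding i l by simp
  ultimately show ?thesis by (simp add: algebra_simps)
qed

text \<open>With \<open>D j = (2 * m) choose (m + j)\<close>, the right side is the sum of
  \<open>2 * j * D j\<close> over \<open>1 \<le> j < k\<close>. Replacing each \<open>D j\<close> by
  the smaller \<open>D k\<close> gives \<open>k * (k - 1) * D k\<close>. The weak form carries the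
  induction from \<open>k = 1\<close>, where both sides vanish.\<close>

lemma binomial_odd_telescope:
  assumes "1 \<le> k" "k \<le> m"
  shows "int (k * (k - 1)) * int ((2 * m) choose (m + k))
      \<le> 2 * int m * (int ((2 * m - 1) choose m) - int ((2 * m - 1) choose (m + k - 1)))
    \<and> (2 \<le> k \<longrightarrow> int (k * (k - 1)) * int ((2 * m) choose (m + k))
      < 2 * int m * (int ((2 * m - 1) choose m) - int ((2 * m - 1) choose (m + k - 1))))"
  using assms
proof (induction k rule: dec_induct)
  case base
  then show ?case by simp
next
  case (step k)
  let ?c = "\<lambda>j. int ((2 * m - 1) choose (m + j - 1))" and ?D = "\<lambda>j. int ((2 * m) choose (m + j))"
  have IH: "int (k * (k - 1)) * ?D k \<le> 2 * int m * (int ((2 * m - 1) choose m) - ?c k)"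
    using step by simp
  \<comment> \<open>Strict decrease past the middle of row \<open>2 * m\<close>; this alone supplies
    the strictness.\<close>
  have "int (Suc k * k) * ?D (Suc k) < int (Suc k * k) * ?D k"
    using step binomial_strict_antimono[of "m + k" "m + Suc k" "2 * m"]
    by (intro mult_strict_left_mono) (auto simp del: of_nat_mult)
  also have "int (Suc k * k) * ?D k = int (k * (k - 1)) * ?D k + 2 * (int k * ?D k)"
    using step by (cases k) (auto simp: algebra_simps)
  also have "\<dots> \<le> 2 * int m * (int ((2 * m - 1) choose m) - ?c k)
                  + 2 * (int m * (?c k - ?c (Suc k)))"
    using IH binomial_odd_difference[of m k] step by simp
  also have "\<dots> = 2 * int m * (int ((2 * m - 1) choose m) - ?c (Suc k))"
    by (simp add: algebra_simps)
  finally show ?case by simp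
qed

lemma binomial_odd_weighted_ineq:
  assumes "2 \<le> k" "k \<le> m" "2 \<le> (t - 1) * (k - 1)"
  shows "t * ((2 * m - 1) choose (m + k - 1))
       < (t - 1) * ((2 * m - 1) choose m) + ((2 * m - 1) choose (m + k))"
proof -
  define c1 ck ck' D where "c1 = int ((2 * m - 1) choose m)"
    and "ck = int ((2 * m - 1) choose (m + k - 1))"
    and "ck' = int ((2 * m - 1) choose (m + k))"
    and "D = int ((2 * m) choose (m + k))"
  note defs = c1_def ck_def ck'_def D_def
  have t: "t \<ge> 2" using assms(3) by (cases "t - 1") auto
  have "2 * (int m * (ck - ck')) = 2 * (int k * D)"
    using binomial_odd_difference[of m k] assms by (simp add: defs)
  also have "\<dots> = int (2 * k) * D"
    by simp
  \<comment> \<open>Trading the constant 2 for \<open>(t - 1) * (k - 1)\<close> produces the factor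
    \<open>k * (k - 1)\<close> of the telescoped bound.\<close>
  also have "\<dots> \<le> int ((t - 1) * (k - 1) * k) * D"
    using assms(3) by (intro mult_right_mono) (auto simp: D_def simp del: of_nat_mult)
  also have "\<dots> = int (t - 1) * (int (k * (k - 1)) * D)"
    by (simp only: of_nat_mult mult_ac)
  also have "\<dots> < int (t - 1) * (2 * int m * (c1 - ck))"
    using binomial_odd_telescope[of k m] assms t
    by (intro mult_strict_left_mono) (auto simp: defs)
  finally have "2 * int m * (ck - ck') < 2 * int m * (int (t - 1) * (c1 - ck))"
    by (simp add: algebra_simps)
  then have "ck - ck' < int (t - 1) * (c1 - ck)"
    using assms by (simp add: mult_less_cancel_left)
  then have "int t * ck < int (t - 1) * c1 + ck'"
    using t by (simp add: algebra_simps of_nat_diff)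
  then have "int (t * ((2 * m - 1) choose (m + k - 1)))
      < int ((t - 1) * ((2 * m - 1) choose m) + ((2 * m - 1) choose (m + k)))"
    by (simp add: defs)
  then show ?thesis by (simp only: of_nat_less_iff)
qed

text \<open>Pascal's rule twice: it moves the star counts from row \<open>2 * m + 1\<close> to row
  \<open>2 * m - 1\<close>, where the Frankl counts live.\<close>

lemma binomial_add_two:
  assumes "j \<ge> 1"
  shows "(Suc (Suc N) choose Suc j) = (N choose (j - 1)) + 2 * (N choose j) + (N choose Suc j)"
  using assms by (cases j) auto

section \<open>Comparison of the two constructions\<close>

text \<open>The terms at size \<open>q + k\<close> stand in for the shadows. In row
  \<open>N = 2 * m - 1\<close>, Frankl minus star is \<open>(t - 1) * (N choose m)\<close> at size
  \<open>q\<close> and \<open>t * (N choose (m + k - 1)) - (N choose (m + k))\<close> at size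
  \<open>q + k\<close>, so the weighted inequality decides.\<close>

lemma frankl_gain_exceeds_star_gain:
  fixes t k m n q :: nat
  assumes "2 \<le> k" "k \<le> m" "2 \<le> (t - 1) * (k - 1)"
    and n: "n = t + 2 * m + 1" and q: "q = t + m"
    and T: "T \<subseteq> {1..n}" "card T = t" and J: "J \<subseteq> {1..n}" "card J = t + 2"
  shows "card (star_family n q T) + card (frankl_family n (q + k) t J)
       < card (frankl_family n q t J) + card (star_family n (q + k) T)"
proof -
  define N where "N = 2 * m - 1"
  have N: "2 * m - 1 = N" "2 * m + 1 = Suc (Suc N)"
    using assms(1,2) by (auto simp: N_def)
  \<comment> \<open>Indexed by the lower entry: the overview's \<open>c\<^sub>j\<close> is
    \<open>c (m + j - 1)\<close> here.\<close>
  define c where "c = (\<lambda>j. N choose j)"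
  have t: "t \<ge> 2" using assms(3) by (cases "t - 1") auto
  \<comment> \<open>Reflection in the odd row \<open>N\<close>; \<open>m \<ge> 2\<close> keeps
    \<open>m - 2\<close> from truncating.\<close>
  have sym: "c (m - 1) = c m" "c (m - 2) = c (Suc m)"
  proof -
    have "m \<le> N" "Suc m \<le> N" "N - m = m - 1" "N - Suc m = m - 2"
      using assms(1,2) by (auto simp: N_def)
    then show "c (m - 1) = c m" "c (m - 2) = c (Suc m)"
      unfolding c_def by (metis binomial_symmetric)+
  qed
  have "card (star_family n q T) = 2 * m + 1 choose m"
    using card_star_family[of T n q] T n q by simp
  also have "\<dots> = c (m - 2) + 2 * c (m - 1) + c m"
    using binomial_add_two[of "m - 1" N] assms N by (simp add: c_def numeral_2_eq_2)
  finally have 1: "card (star_family n q T) = c (Suc m) + 3 * c m"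
    using sym by simp
  have "card (star_family n (q + k) T) = 2 * m + 1 choose (m + k)"
    using card_star_family[of T n "q + k"] T n q by simp
  also have "\<dots> = c (m + k - 2) + 2 * c (m + k - 1) + c (m + k)"
    using binomial_add_two[of "m + k - 1" N] assms N by (simp add: c_def numeral_2_eq_2)
  finally have 2: "card (star_family n (q + k) T) = c (m + k - 2) + 2 * c (m + k - 1) + c (m + k)" .
  have nJ: "n - (t + 2) = N" using n N by simp
  have 3: "card (frankl_family n q t J) = c (Suc m) + (t + 2) * c m"
    using card_frankl_family[OF J, of q] assms nJ sym by (simp add: c_def)
  have 4: "card (frankl_family n (q + k) t J) = c (m + k - 2) + (t + 2) * c (m + k - 1)"
    using card_frankl_family[OF J, of "q + k"] assms nJ by (simp add: c_def)
  have "t * c (m + k - 1) < (t - 1) * c m + c (m + k)"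
    using binomial_odd_weighted_ineq[OF assms(1-3)] N by (simp add: c_def)
  moreover obtain u where "t = Suc u" using t by (cases t) auto
  ultimately show ?thesis
    unfolding 1 2 3 4 by (simp add: algebra_simps)
qed

theorem theorem1p7:
  fixes t k m n q :: nat and T :: "nat set"
  assumes "t \<ge> 2" and "k \<ge> 2" and "k * (t - 1) \<ge> t + 1"
    and "m \<ge> k"
    and "n = t + 2 * m + 1" and "q = (n + t - 1) div 2"
    and "T \<subseteq> {1..n}" and "card T = t"
  shows "\<exists>F. F \<subseteq> Pow {1..n} \<and> t_intersecting t F \<and> k_Sperner k F
           \<and> card F > card (B_family n q k T)"
proof -
  \<comment> \<open>Hence \<open>2 * q + 1 = n + t\<close>, the boundary case of the intersection
    criterion.\<close>
  have q: "q = t + m" using assms by simp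
  \<comment> \<open>The product is \<open>k * (t - 1) - (t - 1)\<close>, at least
    \<open>(t + 1) - (t - 1)\<close>.\<close>
  have tk: "2 \<le> (t - 1) * (k - 1)"
  proof -
    obtain u v where "t = Suc u" "k = Suc v" using assms by (cases t; cases k) auto
    then show ?thesis using assms(3) by (simp add: algebra_simps)
  qed
  \<comment> \<open>\<open>J\<close> is chosen independently of \<open>T\<close>: the counts depend
    only on the sizes of the two sets.\<close>
  define J where "J = {1..t + 2}"
  have J: "J \<subseteq> {1..n}" "card J = t + 2" "finite J"
    using assms by (auto simp: J_def)
  let ?H = "frankl_family n q t J" and ?S = "star_family n q T"
  let ?F = "layered_family n q k ?H"
  have H: "?H \<subseteq> layer n q" and S: "?S \<subseteq> layer n q"
    by (auto simp: frankl_family_def star_family_def)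
  have "?F \<subseteq> Pow {1..n}"
    using layered_family_in_layer(1)[OF H] by auto
  moreover have "t_intersecting t ?F"
    using H t_intersecting_frankl_family[OF J(3,2)] assms q
    by (intro t_intersecting_layered_family) auto
  moreover have "k_Sperner k ?F"
    using H assms by (intro k_Sperner_layered_family) auto
  moreover have "card (B_family n q k T) < card ?F"
  proof -
    have "card (upper_shadow n (q + k) ?H) \<le> card (frankl_family n (q + k) t J)"
      using upper_shadow_frankl_family_subset[OF J(3)]
      by (intro card_mono) (auto simp: frankl_family_def)
    moreover have "card (star_family n (q + k) T) \<le> card (upper_shadow n (q + k) ?S)"
      using star_family_subset_upper_shadow[of T q "q + k" n] assms q
      by (intro card_mono finite_subset[OF upper_shadow_subset_layer])
        (auto intro: finite_subset)
    moreover have "B_family n q k T = layered_family n q k ?S"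
      by (simp add: B_family_def layered_family_def)
    ultimately show ?thesis
      using card_layered_family[OF H, of k] card_layered_family[OF S, of k] assms(2)
        frankl_gain_exceeds_star_gain[OF assms(2,4) tk assms(5) q assms(7,8) J(1,2)]
      by simp
  qed
  ultimately show ?thesis by blast
qed

end
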